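(* Let $X\neq\{0\}$ be a complex Banach space, let $\mathcal{X}$ be one of the sequence spaces $c_0^0(\mathbb{Z}_+,X)$, $l_0^\infty(\mathbb{Z}_+,X)$, or $l_0^p(\mathbb{Z}_+,X)$ with $1\le p<\infty$, and let $\mathcal{U}=\{U(n,m): n\ge m\ge 0\}\subset\mathcal{L}(X)$ be a uniformly exponentially stable discrete evolution family on $X$, i.e. an exponentially bounded discrete evolution family with uniform growth bound $\omega_0(\mathcal{U})<0$. Let $\mathcal{T}_{\mathcal{X}}(1)$ be the first element of the evolution semigroup associated to $\mathcal{U}$ on $\mathcal{X}$, and let $c_{\mathcal{U}}(\mathcal{X})=\sup_{\|f\|_{\mathcal{X}}\le 1}\|U\ast f\|_{\mathcal{X}}$ be the operator norm of the convolution operator $f\mapsto U\ast f$ on $\mathcal{X}$. Then the following three statements hold. (i) $\omega_0(\mathcal{U})\cdot c_{\mathcal{U}}(\mathcal{X})\le -1.$ (ii) The resolvent set $\rho(\mathcal{T}_{\mathcal{X}}(1))$ contains the set $\left\{z\in\mathbb{C}: |z|>1-\frac{1}{c_{\mathcal{U}}(\mathcal{X})}\right\}$. (iii) $\displaystyle\sup_{|z|\ge 1}\|R(z,\mathcal{T}_{\mathcal{X}}(1))\|\le c_{\mathcal{U}}(\mathcal{X})$, where $R(z,\mathcal{T}_{\mathcal{X}}(1))=(zI-\mathcal{T}_{\mathcal{X}}(1))^{-1}$.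
   Context: $\mathbb{Z}_+=\{0,1,2,\dots\}$; $\mathcal{L}(X)$ is the Banach algebra of bounded linear operators on $X$. Sequence spaces: $l_0^\infty(\mathbb{Z}_+,X)$ is the space of bounded $X$-valued sequences $(f_n)_{n\in\mathbb{Z}_+}$ with $f_0=0$, with the sup norm; $c_0^0(\mathbb{Z}_+,X)$ is its closed subspace of sequences with $\lim_{n\to\infty}f_n=0$ (and $f_0=0$), with the sup norm; for $1\le p<\infty$, $l_0^p(\mathbb{Z}_+,X)$ is the space of $X$-valued sequences with $f_0=0$ and $\|f\|_p=(\sum_{k=0}^\infty\|f_k\|^p)^{1/p}<\infty$, with norm $\|\cdot\|_p$. A discrete evolution family is a family $\mathcal{U}=\{U(n,m): n,m\in\mathbb{Z}_+, n\ge m\}\subset\mathcal{L}(X)$ with $U(m,m)=I$ and $U(m,n)=U(m,p)U(p,n)$ for all $m\ge p\ge n$ in $\mathbb{Z}_+$. Let $\Omega(\mathcal{U})$ be the set of real $\omega$ with $\sup_{n\ge m\ge 0}e^{-\omega(n-m)}\|U(n,m)\|<\infty$. The family is exponentially bounded if $\Omega(\mathcal{U})\ne\emptyset$, and its uniform growth bound is $\omega_0(\mathcal{U})=\inf\Omega(\mathcal{U})\in[-\infty,\infty)$. It is uniformly exponentially stable if $\omega_0(\mathcal{U})<0$. If $\omega_0(\mathcal{U})=-\infty$, then the product of $-\infty$ with a positive number is $-\infty$. The evolution semigroup on $\mathcal{X}$ is given, for $j\in\mathbb{Z}_+$ and $f=(f_n)\in\mathcal{X}$, by $(\mathcal{T}_{\mathcal{X}}(j)f)(k)=U(k,k-j)f_{k-j}$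 if $k\ge j$, and $(\mathcal{T}_{\mathcal{X}}(j)f)(k)=0$ if $k<j$; each $\mathcal{T}_{\mathcal{X}}(j)$ is a bounded linear operator on $\mathcal{X}$. The convolution is $(U\ast f)(k)=\sum_{j=0}^k U(k,j)f_j$ for $f=(f_n)\in\mathcal{X}$, $k\in\mathbb{Z}_+$. When $\mathcal{U}$ is uniformly exponentially stable, $f\mapsto U\ast f$ is a bounded linear operator from $\mathcal{X}$ to $\mathcal{X}$, so $c_{\mathcal{U}}(\mathcal{X})$ is finite. *)

theory Defs
  imports "HOL-Analysis.Analysis"
begin

text \<open>The library only provides real normed spaces as type classes. A complex normed space is a
  real one with a compatible complex scalar multiplication.\<close>

class complex_banach = banach +
  fixes scaleC :: "complex \<Rightarrow> 'a \<Rightarrow> 'a"  (infixr "*\<^sub>C" 75)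
  assumes scaleC_add_right: "a *\<^sub>C (x + y) = a *\<^sub>C x + a *\<^sub>C y"
    and scaleC_add_left: "(a + b) *\<^sub>C x = a *\<^sub>C x + b *\<^sub>C x"
    and scaleC_scaleC: "a *\<^sub>C (b *\<^sub>C x) = (a * b) *\<^sub>C x"
    and scaleC_of_real: "complex_of_real r *\<^sub>C x = r *\<^sub>R x"
    and norm_scaleC: "norm (a *\<^sub>C x) = cmod a * norm x"

instantiation complex :: complex_banach
begin

definition scaleC_complex :: "complex \<Rightarrow> complex \<Rightarrow> complex" where
  "scaleC_complex a x = a * x"

instance
  by standard (simp_all add: scaleC_complex_def algebra_simps scaleR_conv_of_real norm_mult)

end

text \<open>\<open>\<L>(X)\<close>: the complex-linear elements of the library's space of bounded real-linear operators.
  The norm of the latter is the usual operator norm, which does not depend on the scalar field.\<close>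

definition complex_blinfuns :: "('a::complex_banach \<Rightarrow>\<^sub>L 'a) set" where
  "complex_blinfuns = {A. \<forall>a x. blinfun_apply A (a *\<^sub>C x) = a *\<^sub>C blinfun_apply A x}"

text \<open>Only the values \<open>U n m\<close> with \<open>m \<le> n\<close> are meaningful; all other values are unconstrained
  and never used.\<close>

definition evolution_family :: "(nat \<Rightarrow> nat \<Rightarrow> 'a::complex_banach \<Rightarrow>\<^sub>L 'a) \<Rightarrow> bool" where
  "evolution_family U \<longleftrightarrow>
     (\<forall>n m. m \<le> n \<longrightarrow> U n m \<in> complex_blinfuns) \<and>
     (\<forall>m. U m m = id_blinfun) \<and>
     (\<forall>m p n. n \<le> p \<and> p \<le> m \<longrightarrow> U m n = U m p o\<^sub>L U p n)"

definition growth_rates :: "(nat \<Rightarrow> nat \<Rightarrow> 'a::complex_banach \<Rightarrow>\<^sub>L 'a) \<Rightarrow> real set" where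
  "growth_rates U =
     {\<omega>. bdd_above {exp (- \<omega> * real (n - m)) * norm (U n m) | n m. m \<le> n}}"

definition exponentially_bounded :: "(nat \<Rightarrow> nat \<Rightarrow> 'a::complex_banach \<Rightarrow>\<^sub>L 'a) \<Rightarrow> bool" where
  "exponentially_bounded U \<longleftrightarrow> growth_rates U \<noteq> {}"

definition growth_bound :: "(nat \<Rightarrow> nat \<Rightarrow> 'a::complex_banach \<Rightarrow>\<^sub>L 'a) \<Rightarrow> ereal" where
  "growth_bound U = Inf (ereal ` growth_rates U)"

definition uniformly_exponentially_stable ::
    "(nat \<Rightarrow> nat \<Rightarrow> 'a::complex_banach \<Rightarrow>\<^sub>L 'a) \<Rightarrow> bool" where
  "uniformly_exponentially_stable U \<longleftrightarrow> exponentially_bounded U \<and> growth_bound U < 0"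

definition evolution_semigroup ::
    "(nat \<Rightarrow> nat \<Rightarrow> 'a::complex_banach \<Rightarrow>\<^sub>L 'a) \<Rightarrow> nat \<Rightarrow> (nat \<Rightarrow> 'a) \<Rightarrow> nat \<Rightarrow> 'a" where
  "evolution_semigroup U j f k = (if j \<le> k then blinfun_apply (U k (k - j)) (f (k - j)) else 0)"

definition convolution ::
    "(nat \<Rightarrow> nat \<Rightarrow> 'a::complex_banach \<Rightarrow>\<^sub>L 'a) \<Rightarrow> (nat \<Rightarrow> 'a) \<Rightarrow> nat \<Rightarrow> 'a" where
  "convolution U f k = (\<Sum>j=0..k. blinfun_apply (U k j) (f j))"

text \<open>A sequence space is given by its carrier \<open>V\<close>, a set of sequences with the pointwise operations,
  and its norm \<open>N\<close>, which is only meaningful on the carrier.\<close>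

definition l0_inf :: "(nat \<Rightarrow> 'a::complex_banach) set" where
  "l0_inf = {f. bounded (range f) \<and> f 0 = 0}"

definition c0_0 :: "(nat \<Rightarrow> 'a::complex_banach) set" where
  "c0_0 = {f \<in> l0_inf. f \<longlonglongrightarrow> 0}"

definition sup_norm :: "(nat \<Rightarrow> 'a::complex_banach) \<Rightarrow> real" where
  "sup_norm f = (SUP n. norm (f n))"

definition l0_p :: "real \<Rightarrow> (nat \<Rightarrow> 'a::complex_banach) set" where
  "l0_p p = {f. summable (\<lambda>k. norm (f k) powr p) \<and> f 0 = 0}"

definition p_norm :: "real \<Rightarrow> (nat \<Rightarrow> 'a::complex_banach) \<Rightarrow> real" where
  "p_norm p f = (\<Sum>k. norm (f k) powr p) powr (1 / p)"

definition admissible_space ::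
    "(nat \<Rightarrow> 'a::complex_banach) set \<Rightarrow> ((nat \<Rightarrow> 'a) \<Rightarrow> real) \<Rightarrow> bool" where
  "admissible_space V N \<longleftrightarrow>
     (V = c0_0 \<and> N = sup_norm) \<or>
     (V = l0_inf \<and> N = sup_norm) \<or>
     (\<exists>p\<ge>1. V = l0_p p \<and> N = p_norm p)"

text \<open>The supremum is taken in the extended reals, so that it is \<open>\<infinity>\<close> for an unbounded
  linear map of \<open>V\<close> into itself.\<close>

definition operator_norm ::
    "(nat \<Rightarrow> 'a::complex_banach) set \<Rightarrow> ((nat \<Rightarrow> 'a) \<Rightarrow> real) \<Rightarrow>
     ((nat \<Rightarrow> 'a) \<Rightarrow> nat \<Rightarrow> 'a) \<Rightarrow> ereal" where
  "operator_norm V N A = (SUP f\<in>{f \<in> V. N f \<le> 1}. ereal (N (A f)))"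

definition bounded_operator ::
    "(nat \<Rightarrow> 'a::complex_banach) set \<Rightarrow> ((nat \<Rightarrow> 'a) \<Rightarrow> real) \<Rightarrow>
     ((nat \<Rightarrow> 'a) \<Rightarrow> nat \<Rightarrow> 'a) \<Rightarrow> bool" where
  "bounded_operator V N A \<longleftrightarrow>
     (\<forall>f\<in>V. A f \<in> V) \<and>
     (\<forall>f\<in>V. \<forall>g\<in>V. A (\<lambda>k. f k + g k) = (\<lambda>k. A f k + A g k)) \<and>
     (\<forall>a. \<forall>f\<in>V. A (\<lambda>k. a *\<^sub>C f k) = (\<lambda>k. a *\<^sub>C A f k)) \<and>
     (\<exists>K. \<forall>f\<in>V. N (A f) \<le> K * N f)"

definition scalar_minus ::
    "complex \<Rightarrow> ((nat \<Rightarrow> 'a::complex_banach) \<Rightarrow> nat \<Rightarrow> 'a) \<Rightarrow> (nat \<Rightarrow> 'a) \<Rightarrow> nat \<Rightarrow> 'a" where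
  "scalar_minus z T f k = z *\<^sub>C f k - T f k"

definition resolvent ::
    "(nat \<Rightarrow> 'a::complex_banach) set \<Rightarrow> complex \<Rightarrow> ((nat \<Rightarrow> 'a) \<Rightarrow> nat \<Rightarrow> 'a) \<Rightarrow>
     (nat \<Rightarrow> 'a) \<Rightarrow> nat \<Rightarrow> 'a" where
  "resolvent V z T = inv_into V (scalar_minus z T)"

definition resolvent_set ::
    "(nat \<Rightarrow> 'a::complex_banach) set \<Rightarrow> ((nat \<Rightarrow> 'a) \<Rightarrow> real) \<Rightarrow>
     ((nat \<Rightarrow> 'a) \<Rightarrow> nat \<Rightarrow> 'a) \<Rightarrow> complex set" where
  "resolvent_set V N T =
     {z. bij_betw (scalar_minus z T) V V \<and> bounded_operator V N (resolvent V z T)}"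

definition convolution_norm ::
    "(nat \<Rightarrow> 'a::complex_banach) set \<Rightarrow> ((nat \<Rightarrow> 'a) \<Rightarrow> real) \<Rightarrow>
     (nat \<Rightarrow> nat \<Rightarrow> 'a \<Rightarrow>\<^sub>L 'a) \<Rightarrow> ereal" where
  "convolution_norm V N U = operator_norm V N (convolution U)"

end

theory Submission
  imports Defs
begin

text \<open>For \<open>T = \<T>(1)\<close> and \<open>z \<noteq> 0\<close>, the resolvent \<open>(z - T)\<^sup>-\<^sup>1\<close> has the kernel
  \<open>z\<^sup>-\<^sup>(\<^sup>k\<^sup>-\<^sup>j\<^sup>)\<^sup>-\<^sup>1 U(k, j)\<close>, and the convolution operator is \<open>(1 - T)\<^sup>-\<^sup>1\<close>. A Neumann argument for
  \<open>\<rho> - T = (1 - T) - (1 - \<rho>)\<close> gives \<open>\<parallel>U(k, j)\<parallel> \<le> M \<rho>\<^sup>k\<^sup>-\<^sup>j\<close> for every \<open>\<rho>\<close> with \<open>1 - 1/c < \<rho> < 1\<close>. Hence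
  the growth bound is at most \<open>ln \<rho> \<le> \<rho> - 1\<close>, which yields (i) as \<open>\<rho>\<close> tends to \<open>1 - 1/c\<close>, and the
  kernel of the resolvent decays geometrically for \<open>|z| > 1 - 1/c\<close>, which yields (ii). For (iii),
  conjugation with unimodular diagonal operators is isometric on each of the spaces; this reduces
  the claim to \<open>z \<ge> 1\<close>, where the multiplier \<open>z\<^sup>-\<^sup>(\<^sup>k\<^sup>-\<^sup>j\<^sup>)\<close> of the kernel is a limit of iterated convex
  combinations of conjugations by diagonal signs, and so does not increase the norm.\<close>

section \<open>Complex scalars\<close>

lemma scaleC_one [simp]: "1 *\<^sub>C x = x"
  using scaleC_of_real[of 1 x] by simp

lemma scaleC_zero_left [simp]: "0 *\<^sub>C x = 0"
  using scaleC_of_real[of 0 x] by simp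

lemma scaleC_zero_right [simp]: "a *\<^sub>C (0::'a::complex_banach) = 0"
  using norm_scaleC[of a "0::'a"] by simp

lemma scaleC_minus_right: "a *\<^sub>C (- x) = - (a *\<^sub>C x)"
  using scaleC_add_right[of a x "- x"] by (simp add: eq_neg_iff_add_eq_0 add.commute)

lemma scaleC_diff_right: "a *\<^sub>C (x - y) = a *\<^sub>C x - a *\<^sub>C y"
  using scaleC_add_right[of a x "- y"] by (simp add: scaleC_minus_right)

lemma scaleC_sum_right: "a *\<^sub>C (\<Sum>i\<in>I. f i) = (\<Sum>i\<in>I. a *\<^sub>C f i)"
  by (induction I rule: infinite_finite_induct) (simp_all add: scaleC_add_right)

section \<open>Sequence spaces\<close>

definition truncate :: "nat \<Rightarrow> (nat \<Rightarrow> 'a::zero) \<Rightarrow> nat \<Rightarrow> 'a" where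
  "truncate K f k = (if k \<le> K then f k else 0)"

text \<open>The interface through which the three spaces enter the argument.
  \<open>dominated\<close> combines solidity with right shifts by \<open>n\<close>. The norm
  \<open>N\<close> carries information only on \<open>V\<close>, so \<open>closed\<close> and
  \<open>fatou\<close> are phrased with truncations, which lie in \<open>V\<close> as soon as the
  entry at 0 vanishes. \<open>closed\<close> asks for approximants \<open>h\<close> in
  \<open>V\<close>, because bounded truncations alone do not force convergence to 0, as
  \<open>c0_0\<close> demands.\<close>

locale sequence_space =
  fixes V :: "(nat \<Rightarrow> 'a::complex_banach) set" and N :: "(nat \<Rightarrow> 'a) \<Rightarrow> real"
  assumes vanish: "f \<in> V \<Longrightarrow> f 0 = 0"
    and add_mem: "f \<in> V \<Longrightarrow> g \<in> V \<Longrightarrow> (\<lambda>k. f k + g k) \<in> V"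
    and norm_add: "f \<in> V \<Longrightarrow> g \<in> V \<Longrightarrow> N (\<lambda>k. f k + g k) \<le> N f + N g"
    and dominated: "f \<in> V \<Longrightarrow> 0 \<le> r \<Longrightarrow> (\<And>k. k < n \<Longrightarrow> g k = 0) \<Longrightarrow>
          (\<And>k. norm (g (k + n)) \<le> r * norm (f k)) \<Longrightarrow> g \<in> V \<and> N g \<le> r * N f"
    and single: "0 < j \<Longrightarrow> (\<lambda>k. if k = j then x else 0) \<in> V \<and>
          N (\<lambda>k. if k = j then x else 0) \<le> norm x"
    and coord: "f \<in> V \<Longrightarrow> norm (f k) \<le> N f"
    and closed: "g 0 = 0 \<Longrightarrow>
          (\<And>e. 0 < e \<Longrightarrow> \<exists>h\<in>V. \<forall>K. N (truncate K (\<lambda>k. g k - h k)) \<le> e) \<Longrightarrow> g \<in> V"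
    and fatou: "g \<in> V \<Longrightarrow> (\<And>K. N (truncate K g) \<le> r) \<Longrightarrow> N g \<le> r"
begin

lemma norm_nonneg: "f \<in> V \<Longrightarrow> 0 \<le> N f"
  using coord[of f 0] norm_ge_zero order_trans by blast

lemma dominated0:
  assumes "f \<in> V" "0 \<le> r" "\<And>k. norm (g k) \<le> r * norm (f k)"
  shows "g \<in> V" "N g \<le> r * N f"
  using dominated[of f r 0 g] assms by auto

lemma scaleC_mem: "f \<in> V \<Longrightarrow> (\<lambda>k. a *\<^sub>C f k) \<in> V"
  using dominated0(1)[of f "cmod a" "\<lambda>k. a *\<^sub>C f k"] by (simp add: norm_scaleC)

lemma norm_scaleC_le: "f \<in> V \<Longrightarrow> N (\<lambda>k. a *\<^sub>C f k) \<le> cmod a * N f"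
  using dominated0(2)[of f "cmod a" "\<lambda>k. a *\<^sub>C f k"] by (simp add: norm_scaleC)

lemma zero_mem: "(\<lambda>k. 0) \<in> V" and norm_zero: "N (\<lambda>k. 0) = 0"
proof -
  have 1: "(\<lambda>k. 0) \<in> V" "N (\<lambda>k. 0) \<le> 0"
    using single[of 1 0] by auto
  then show "(\<lambda>k. 0) \<in> V" "N (\<lambda>k. 0) = 0"
    using norm_nonneg by force+
qed

lemma sum_mem:
  assumes "\<And>i. i \<in> I \<Longrightarrow> F i \<in> V"
  shows "(\<lambda>k. \<Sum>i\<in>I. F i k) \<in> V \<and> N (\<lambda>k. \<Sum>i\<in>I. F i k) \<le> (\<Sum>i\<in>I. N (F i))"
  using assms
proof (induction I rule: infinite_finite_induct)
  case (insert i I)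
  have 1: "F i \<in> V" "(\<lambda>k. \<Sum>i\<in>I. F i k) \<in> V"
    "N (\<lambda>k. \<Sum>i\<in>I. F i k) \<le> (\<Sum>i\<in>I. N (F i))"
    using insert by auto
  show ?case
    using add_mem[OF 1(1,2)] norm_add[OF 1(1,2)] 1(3) insert.hyps by simp
qed (simp_all add: zero_mem norm_zero)

lemma truncate_mem:
  assumes "g 0 = 0"
  shows "truncate K g \<in> V"
proof (induction K)
  case 0
  have "truncate 0 g = (\<lambda>k. 0)"
    using assms by (auto simp: truncate_def)
  then show ?case
    by (simp add: zero_mem)
next
  case (Suc K)
  have "truncate (Suc K) g = (\<lambda>k. truncate K g k + (if k = Suc K then g (Suc K) else 0))"
    by (auto simp: truncate_def le_Suc_eq)
  then show ?case
    using add_mem[OF Suc] single[of "Suc K" "g (Suc K)"] by simp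
qed

lemma norm_truncate_le: "f \<in> V \<Longrightarrow> N (truncate K f) \<le> N f"
  using dominated0(2)[of f 1 "truncate K f"] by (simp add: truncate_def)

end

subsection \<open>The spaces with the supremum norm\<close>

lemma sup_norm_le: "(\<And>k. norm (f k) \<le> r) \<Longrightarrow> sup_norm f \<le> r"
  unfolding sup_norm_def by (rule cSUP_least) auto

lemma norm_le_sup_norm:
  assumes "bounded (range f)"
  shows "norm (f k) \<le> sup_norm f"
  unfolding sup_norm_def
proof (rule cSUP_upper)
  show "bdd_above (range (\<lambda>n. norm (f n)))"
    using assms by (auto simp: bounded_iff bdd_above_def)
qed simp

lemma sup_norm_dominated:
  assumes "bounded (range f)" "0 \<le> r" "\<And>k. k < n \<Longrightarrow> g k = 0"
    "\<And>k. norm (g (k + n)) \<le> r * norm (f k)"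
  shows "norm (g k) \<le> r * sup_norm f"
proof (cases "k < n")
  case True
  then show ?thesis
    using assms(2,3) norm_le_sup_norm[OF assms(1), of 0]
    by (simp add: order_trans[OF norm_ge_zero])
next
  case False
  then have "norm (g k) \<le> r * norm (f (k - n))"
    using assms(4)[of "k - n"] by simp
  also have "\<dots> \<le> r * sup_norm f"
    by (intro mult_left_mono norm_le_sup_norm assms)
  finally show ?thesis .
qed

lemma bounded_range_iff: "bounded (range f) \<longleftrightarrow> (\<exists>r. \<forall>k. norm (f k) \<le> r)"
  by (auto simp: bounded_iff)

text \<open>The sequence \<open>f\<close> may be unbounded a priori; its truncation at
  \<open>k\<close> has finite range, so the supremum there dominates the entry.\<close>

lemma norm_le_of_truncate:
  assumes "\<And>K. sup_norm (truncate K f) \<le> r"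
  shows "norm (f k) \<le> r"
proof -
  have "bounded (range (truncate k f))"
  proof (rule finite_imp_bounded, rule finite_subset)
    show "range (truncate k f) \<subseteq> insert 0 (f ` {..k})"
      by (auto simp: truncate_def)
  qed simp
  from norm_le_sup_norm[OF this, of k] show ?thesis
    using assms[of k] by (simp add: truncate_def)
qed

lemma sequence_space_l0_inf:
  "sequence_space (l0_inf :: (nat \<Rightarrow> 'a::complex_banach) set) sup_norm"
proof
  fix f g :: "nat \<Rightarrow> 'a" and r :: real and n j :: nat and x :: 'a
  show "f 0 = 0" if "f \<in> l0_inf" using that by (simp add: l0_inf_def)
  { assume f: "f \<in> l0_inf" and g: "g \<in> l0_inf"
    have le: "norm (f k + g k) \<le> sup_norm f + sup_norm g" for k
      using f g by (intro norm_triangle_mono norm_le_sup_norm) (auto simp: l0_inf_def)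
    show "(\<lambda>k. f k + g k) \<in> l0_inf"
      using le f g unfolding l0_inf_def bounded_range_iff by auto
    show "sup_norm (\<lambda>k. f k + g k) \<le> sup_norm f + sup_norm g"
      by (rule sup_norm_le) (rule le) }
  { assume f: "f \<in> l0_inf" and r: "0 \<le> r" and z: "\<And>k. k < n \<Longrightarrow> g k = 0"
      and d: "\<And>k. norm (g (k + n)) \<le> r * norm (f k)"
    have le: "norm (g k) \<le> r * sup_norm f" for k
      using f by (intro sup_norm_dominated[of f r n g, OF _ r z d]) (auto simp: l0_inf_def)
    have "g 0 = 0"
      using z[of 0] d[of 0] f by (cases "n = 0") (auto simp: l0_inf_def)
    then show "g \<in> l0_inf \<and> sup_norm g \<le> r * sup_norm f"
      using le by (auto simp: l0_inf_def bounded_range_iff intro: sup_norm_le) }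
  show "(\<lambda>k. if k = j then x else 0) \<in> l0_inf \<and>
      sup_norm (\<lambda>k. if k = j then x else 0) \<le> norm x" if "0 < j"
    using that by (auto simp: l0_inf_def bounded_range_iff intro: sup_norm_le)
  show "norm (f n) \<le> sup_norm f" if "f \<in> l0_inf"
    using that by (intro norm_le_sup_norm) (simp add: l0_inf_def)
  show "sup_norm g \<le> r" if "\<And>K. sup_norm (truncate K g) \<le> r"
    by (rule sup_norm_le) (rule norm_le_of_truncate[OF that])
  { assume g: "g 0 = 0" and
      ex: "\<And>e. 0 < e \<Longrightarrow> \<exists>h\<in>l0_inf. \<forall>K. sup_norm (truncate K (\<lambda>k. g k - h k)) \<le> e"
    obtain h where h: "h \<in> l0_inf" "\<And>K. sup_norm (truncate K (\<lambda>k. g k - h k)) \<le> 1"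
      using ex[of 1] by auto
    have "norm (g k) \<le> sup_norm h + 1" for k
      using norm_le_of_truncate[OF h(2), of k] norm_triangle_sub[of "g k" "h k"]
        norm_le_sup_norm[of h k] h(1) by (auto simp: l0_inf_def)
    then show "g \<in> l0_inf"
      using g by (auto simp: l0_inf_def bounded_range_iff) }
qed

lemma sequence_space_c0_0:
  "sequence_space (c0_0 :: (nat \<Rightarrow> 'a::complex_banach) set) sup_norm"
proof -
  interpret l: sequence_space "l0_inf :: (nat \<Rightarrow> 'a) set" sup_norm
    by (rule sequence_space_l0_inf)
  show ?thesis
  proof
    fix f g :: "nat \<Rightarrow> 'a" and r :: real and n j :: nat and x :: 'a
    show "f 0 = 0" if "f \<in> c0_0" using that l.vanish by (simp add: c0_0_def)
    { assume f: "f \<in> c0_0" and g: "g \<in> c0_0"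
      show "(\<lambda>k. f k + g k) \<in> c0_0"
        using f g l.add_mem tendsto_add[of f 0 sequentially g 0] by (simp add: c0_0_def)
      show "sup_norm (\<lambda>k. f k + g k) \<le> sup_norm f + sup_norm g"
        using f g l.norm_add by (simp add: c0_0_def) }
    { assume f: "f \<in> c0_0" and r: "0 \<le> r" and z: "\<And>k. k < n \<Longrightarrow> g k = 0"
        and d: "\<And>k. norm (g (k + n)) \<le> r * norm (f k)"
      have "(\<lambda>k. r * norm (f k)) \<longlonglongrightarrow> r * 0"
        using f by (intro tendsto_intros tendsto_norm_zero) (simp add: c0_0_def)
      then have "(\<lambda>k. g (k + n)) \<longlonglongrightarrow> 0"
        using d by (intro Lim_null_comparison[of "\<lambda>k. g (k + n)"]) (auto intro: always_eventually)
      then have "g \<longlonglongrightarrow> 0"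
        by (rule LIMSEQ_offset)
      then show "g \<in> c0_0 \<and> sup_norm g \<le> r * sup_norm f"
        using l.dominated[of f r n g, OF _ r z d] f by (simp add: c0_0_def) }
    { assume j: "0 < j"
      have "(\<lambda>k. if k = j then x else 0) \<longlonglongrightarrow> 0"
        by (rule tendsto_eventually) (use eventually_gt_at_top[of j] in eventually_elim, simp)
      then show "(\<lambda>k. if k = j then x else 0) \<in> c0_0 \<and>
          sup_norm (\<lambda>k. if k = j then x else 0) \<le> norm x"
        using l.single[OF j, of x] by (simp add: c0_0_def) }
    show "norm (f n) \<le> sup_norm f" if "f \<in> c0_0"
      using that l.coord by (simp add: c0_0_def)
    show "sup_norm g \<le> r" if "g \<in> c0_0" "\<And>K. sup_norm (truncate K g) \<le> r"
      using that l.fatou by (simp add: c0_0_def)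
    { assume g: "g 0 = 0" and
        ex: "\<And>e. 0 < e \<Longrightarrow> \<exists>h\<in>c0_0. \<forall>K. sup_norm (truncate K (\<lambda>k. g k - h k)) \<le> e"
      have "g \<in> l0_inf"
        by (rule l.closed[of g, OF g]) (use ex in \<open>fastforce simp: c0_0_def\<close>)
      \<comment> \<open>An approximant in \<open>c0_0\<close> that is uniformly within
        \<open>e / 2\<close> of \<open>g\<close> has entries below \<open>e / 2\<close> eventually,
        which controls the tail of \<open>g\<close>.\<close>
      moreover have "g \<longlonglongrightarrow> 0"
      proof (rule LIMSEQ_I)
        fix e :: real assume "0 < e"
        then obtain h where h: "h \<in> c0_0"
          "\<And>K. sup_norm (truncate K (\<lambda>k. g k - h k)) \<le> e / 2"
          using ex[of "e / 2"] by auto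
        obtain m where m: "\<And>k. k \<ge> m \<Longrightarrow> norm (h k) < e / 2"
          using h(1) \<open>0 < e\<close> LIMSEQ_D[of h 0 "e / 2"] by (auto simp: c0_0_def)
        have "norm (g k) < e" if "k \<ge> m" for k
          using norm_le_of_truncate[OF h(2), of k] norm_triangle_sub[of "g k" "h k"]
            m[OF that] by simp
        then show "\<exists>m. \<forall>k\<ge>m. norm (g k - 0) < e" by auto
      qed
      ultimately show "g \<in> c0_0" by (simp add: c0_0_def) }
  qed
qed

subsection \<open>The spaces with the p-norm\<close>

text \<open>Convexity on the positive half-line, extended to the boundary: if \<open>x\<close> or
  \<open>y\<close> vanishes, the claim becomes \<open>(s * v) powr p \<le> s * v powr p\<close>,
  which holds since \<open>s powr p \<le> s\<close> for \<open>s\<close> in [0, 1].\<close>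

lemma powr_convex_nonneg:
  fixes p t x y :: real
  assumes p: "1 \<le> p" and t: "0 \<le> t" "t \<le> 1" and xy: "0 \<le> x" "0 \<le> y"
  shows "(t * x + (1 - t) * y) powr p \<le> t * x powr p + (1 - t) * y powr p"
proof -
  have contract: "(s * v) powr p \<le> s * v powr p" if "0 \<le> s" "s \<le> 1" "0 \<le> v" for s v :: real
  proof -
    have "s powr p \<le> s powr 1"
      using powr_mono'[of 1 p s] that p by simp
    then show ?thesis
      using that by (simp add: powr_mult mult_right_mono)
  qed
  consider "x = 0" | "y = 0" | "x > 0" "y > 0"
    using xy by fastforce
  then show ?thesis
  proof cases
    case 3
    then show ?thesis
      using convex_onD[OF powr_convex[OF p] t(1) t(2), of y x] by (simp add: add.commute)
  qed (use contract t xy in auto)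
qed

lemma p_norm_le_iff:
  assumes p: "1 \<le> p" and f: "f \<in> l0_p p" and r: "0 \<le> r"
  shows "p_norm p f \<le> r \<longleftrightarrow> (\<Sum>k. norm (f k) powr p) \<le> r powr p"
proof -
  let ?S = "\<Sum>k. norm (f k) powr p"
  have S: "0 \<le> ?S"
    using f by (intro suminf_nonneg) (auto simp: l0_p_def)
  have 1: "(?S powr (1 / p)) powr p = ?S" "(r powr p) powr (1 / p) = r"
    using p S r by (simp_all add: powr_powr)
  show ?thesis
    unfolding p_norm_def
    using powr_mono2[of p "?S powr (1 / p)" r] powr_mono2[of "1 / p" ?S "r powr p"] p S r 1
    by auto
qed

lemma p_norm_nonneg: "0 \<le> p_norm p f"
  by (simp add: p_norm_def)

lemma l0_p_boundedI:
  assumes p: "1 \<le> p" and "f 0 = 0" and r: "0 \<le> r"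
    and le: "\<And>n. (\<Sum>k<n. norm (f k) powr p) \<le> r powr p"
  shows "f \<in> l0_p p" "p_norm p f \<le> r"
proof -
  have "summable (\<lambda>k. norm (f k) powr p)"
    by (rule summableI_nonneg_bounded[OF _ le]) simp
  then show mem: "f \<in> l0_p p"
    using assms(2) by (simp add: l0_p_def)
  show "p_norm p f \<le> r"
    unfolding p_norm_le_iff[OF p mem r]
    by (rule suminf_le_const[OF _ le]) fact
qed

lemma l0_p_partial_sum_le:
  assumes p: "1 \<le> p" and f: "f \<in> l0_p p" and r: "p_norm p f \<le> r"
  shows "(\<Sum>k<n. norm (f k) powr p) \<le> r powr p"
proof -
  have "(\<Sum>k<n. norm (f k) powr p) \<le> (\<Sum>k. norm (f k) powr p)"
    using f by (intro sum_le_suminf) (auto simp: l0_p_def)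
  also have "\<dots> \<le> r powr p"
    using p_norm_le_iff[OF p f order_trans[OF p_norm_nonneg r]] r by simp
  finally show ?thesis .
qed

lemma l0_p_truncate:
  assumes "f 0 = 0"
  shows "truncate K f \<in> l0_p p"
proof -
  have "summable (\<lambda>k. norm (truncate K f k) powr p)"
    by (rule summable_finite[of "{..K}"]) (auto simp: truncate_def)
  then show ?thesis
    using assms by (simp add: l0_p_def truncate_def)
qed

text \<open>Minkowski's inequality follows from convexity: up to the factor \<open>a + b\<close>, the sum is a convex
  combination of \<open>f / a\<close> and \<open>g / b\<close>, which lie in the unit ball.\<close>

lemma p_norm_add:
  fixes f g :: "nat \<Rightarrow> 'a::complex_banach"
  assumes p: "1 \<le> p" and f: "f \<in> l0_p p" and g: "g \<in> l0_p p"
  shows "(\<lambda>k. f k + g k) \<in> l0_p p" "p_norm p (\<lambda>k. f k + g k) \<le> p_norm p f + p_norm p g"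
proof -
  have z: "f 0 + g 0 = 0"
    using f g by (simp add: l0_p_def)
  \<comment> \<open>The norms may be zero, so the division is by positive upper bounds
    \<open>a\<close> and \<open>b\<close>; below these are the norms plus \<open>e / 2\<close>, with
    \<open>e\<close> arbitrarily small.\<close>
  have main: "(\<Sum>k<n. norm (f k + g k) powr p) \<le> (a + b) powr p"
    if ab: "0 < a" "0 < b" "p_norm p f \<le> a" "p_norm p g \<le> b" for a b n
  proof -
    define t where "t = a / (a + b)"
    have t: "0 \<le> t" "t \<le> 1" "1 - t = b / (a + b)"
      using ab by (auto simp: t_def field_simps)
    have "norm (f k + g k) powr p
        \<le> (a + b) powr p * (t * (norm (f k) powr p / a powr p)
            + (1 - t) * (norm (g k) powr p / b powr p))" for k
    proof -
      have "norm (f k + g k) powr p \<le> (norm (f k) + norm (g k)) powr p"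
        using p by (intro powr_mono2 norm_triangle_ineq) auto
      also have "norm (f k) + norm (g k)
          = (a + b) * (t * (norm (f k) / a) + (1 - t) * (norm (g k) / b))"
      proof -
        have "(a + b) * t = a" "(a + b) * (1 - t) = b"
          unfolding t(3) using ab by (simp_all add: t_def)
        then have "(a + b) * (t * (norm (f k) / a) + (1 - t) * (norm (g k) / b))
            = a * (norm (f k) / a) + b * (norm (g k) / b)"
          by (metis distrib_left mult.assoc)
        then show ?thesis
          using ab by simp
      qed
      also have "\<dots> powr p
          = (a + b) powr p * (t * (norm (f k) / a) + (1 - t) * (norm (g k) / b)) powr p"
        using ab t by (intro powr_mult)
      also have "\<dots> \<le> (a + b) powr p * (t * (norm (f k) / a) powr p
          + (1 - t) * (norm (g k) / b) powr p)"
        using ab t p by (intro mult_left_mono powr_convex_nonneg) auto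
      finally show ?thesis
        using ab by (simp add: powr_divide)
    qed
    then have "(\<Sum>k<n. norm (f k + g k) powr p)
        \<le> (\<Sum>k<n. (a + b) powr p * (t * (norm (f k) powr p / a powr p)
            + (1 - t) * (norm (g k) powr p / b powr p)))"
      by (intro sum_mono)
    also have "\<dots> = (a + b) powr p * (t * ((\<Sum>k<n. norm (f k) powr p) / a powr p)
            + (1 - t) * ((\<Sum>k<n. norm (g k) powr p) / b powr p))"
      by (simp add: sum.distrib flip: sum_distrib_left sum_divide_distrib)
    also have "\<dots> \<le> (a + b) powr p * (t * 1 + (1 - t) * 1)"
      using ab t l0_p_partial_sum_le[OF p f ab(3), of n] l0_p_partial_sum_le[OF p g ab(4), of n]
      by (intro mult_left_mono add_mono) (auto simp: divide_le_eq_1)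
    finally show ?thesis by simp
  qed
  have le: "p_norm p (\<lambda>k. f k + g k) \<le> (p_norm p f + e / 2) + (p_norm p g + e / 2)"
    and mem: "(\<lambda>k. f k + g k) \<in> l0_p p" if "0 < e" for e
    using l0_p_boundedI[of p "\<lambda>k. f k + g k", OF p z _ main[of "p_norm p f + e / 2" "p_norm p g + e / 2"]]
      that p_norm_nonneg[of p f] p_norm_nonneg[of p g]
    by auto
  show "(\<lambda>k. f k + g k) \<in> l0_p p"
    using mem[of 1] by simp
  show "p_norm p (\<lambda>k. f k + g k) \<le> p_norm p f + p_norm p g"
    by (rule field_le_epsilon) (use le in fastforce)
qed

lemma l0_p_dominated:
  fixes f g :: "nat \<Rightarrow> 'a::complex_banach"
  assumes p: "1 \<le> p" and f: "f \<in> l0_p p" and r: "0 \<le> r" and z: "\<And>k. k < n \<Longrightarrow> g k = 0"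
    and d: "\<And>k. norm (g (k + n)) \<le> r * norm (f k)"
  shows "g \<in> l0_p p" "p_norm p g \<le> r * p_norm p f"
proof -
  have "(\<Sum>k<m. norm (g k) powr p) \<le> (r * p_norm p f) powr p" for m
  proof -
    \<comment> \<open>After extending the range to \<open>n + m\<close>, the first \<open>n\<close>
      terms vanish and the remaining \<open>m\<close> are exactly those controlled by
      \<open>d\<close>.\<close>
    have "(\<Sum>k<m. norm (g k) powr p) \<le> (\<Sum>k<n + m. norm (g k) powr p)"
      by (intro sum_mono2) auto
    also have "\<dots> = (\<Sum>k<m. norm (g (k + n)) powr p)"
    proof -
      have "(\<Sum>k<n + m. norm (g k) powr p)
          = (\<Sum>k<n. norm (g k) powr p) + (\<Sum>k<m. norm (g (k + n)) powr p)"
        by (induction m) (auto simp: add.commute add.assoc)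
      then show ?thesis
        using z by simp
    qed
    also have "\<dots> \<le> (\<Sum>k<m. r powr p * norm (f k) powr p)"
    proof (rule sum_mono)
      fix k
      have "norm (g (k + n)) powr p \<le> (r * norm (f k)) powr p"
        using d p by (intro powr_mono2) auto
      then show "norm (g (k + n)) powr p \<le> r powr p * norm (f k) powr p"
        using r by (simp add: powr_mult)
    qed
    also have "\<dots> = r powr p * (\<Sum>k<m. norm (f k) powr p)"
      by (simp add: sum_distrib_left)
    also have "\<dots> \<le> r powr p * p_norm p f powr p"
      by (intro mult_left_mono l0_p_partial_sum_le[OF p f]) auto
    finally show ?thesis
      using r p_norm_nonneg[of p f] by (simp add: powr_mult)
  qed
  moreover have "g 0 = 0"
    using z[of 0] d[of 0] f by (cases "n = 0") (auto simp: l0_p_def)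
  moreover have "0 \<le> r * p_norm p f"
    using r p_norm_nonneg[of p f] by simp
  ultimately show "g \<in> l0_p p" "p_norm p g \<le> r * p_norm p f"
    using l0_p_boundedI[OF p] by blast+
qed

lemma l0_p_of_truncate:
  fixes f :: "nat \<Rightarrow> 'a::complex_banach"
  assumes p: "1 \<le> p" and "f 0 = 0" and le: "\<And>K. p_norm p (truncate K f) \<le> r"
  shows "f \<in> l0_p p" "p_norm p f \<le> r"
proof -
  have r: "0 \<le> r"
    using p_norm_nonneg le order_trans by blast
  have "(\<Sum>k<n. norm (f k) powr p) \<le> r powr p" for n
  proof -
    have "(\<Sum>k<n. norm (f k) powr p) = (\<Sum>k<n. norm (truncate n f k) powr p)"
      by (intro sum.cong) (auto simp: truncate_def)
    also have "\<dots> \<le> r powr p"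
      by (rule l0_p_partial_sum_le[OF p l0_p_truncate[of f, OF assms(2)] le])
    finally show ?thesis .
  qed
  then show "f \<in> l0_p p" "p_norm p f \<le> r"
    using l0_p_boundedI[of p f r, OF p assms(2) r] by blast+
qed

lemma sequence_space_l0_p:
  assumes p: "1 \<le> p"
  shows "sequence_space (l0_p p :: (nat \<Rightarrow> 'a::complex_banach) set) (p_norm p)"
proof
  fix f g :: "nat \<Rightarrow> 'a" and r :: real and n j :: nat and x :: 'a
  show "f 0 = 0" if "f \<in> l0_p p" using that by (simp add: l0_p_def)
  show "(\<lambda>k. f k + g k) \<in> l0_p p" "p_norm p (\<lambda>k. f k + g k) \<le> p_norm p f + p_norm p g"
    if "f \<in> l0_p p" "g \<in> l0_p p"
    using p_norm_add[OF p that] by simp_all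
  show "g \<in> l0_p p \<and> p_norm p g \<le> r * p_norm p f"
    if "f \<in> l0_p p" "0 \<le> r" "\<And>k. k < n \<Longrightarrow> g k = 0" "\<And>k. norm (g (k + n)) \<le> r * norm (f k)"
    using l0_p_dominated[OF p that] by simp
  { assume j: "0 < j"
    have "(\<Sum>k<m. norm (if k = j then x else 0) powr p) \<le> norm x powr p" for m
    proof -
      have "(\<Sum>k<m. norm (if k = j then x else 0) powr p)
          = (\<Sum>k<m. if k = j then norm x powr p else 0)"
        by (intro sum.cong) auto
      then show ?thesis by simp
    qed
    then show "(\<lambda>k. if k = j then x else 0) \<in> l0_p p \<and>
        p_norm p (\<lambda>k. if k = j then x else 0) \<le> norm x"
      using l0_p_boundedI[OF p, of "\<lambda>k. if k = j then x else 0" "norm x"] j by auto }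
  { assume f: "f \<in> l0_p p"
    have "norm (f n) powr p \<le> (\<Sum>k<Suc n. norm (f k) powr p)"
      by (simp add: sum_nonneg)
    also have "\<dots> \<le> p_norm p f powr p"
      by (rule l0_p_partial_sum_le[OF p f]) simp
    finally show "norm (f n) \<le> p_norm p f"
      using p p_norm_nonneg[of p f] powr_less_mono2[of p "p_norm p f" "norm (f n)"] by force }
  show "p_norm p g \<le> r" if "g \<in> l0_p p" "\<And>K. p_norm p (truncate K g) \<le> r"
    using l0_p_of_truncate(2)[OF p _ that(2)] that(1) by (simp add: l0_p_def)
  { assume g: "g 0 = 0" and
      ex: "\<And>e. 0 < e \<Longrightarrow> \<exists>h\<in>l0_p p. \<forall>K. p_norm p (truncate K (\<lambda>k. g k - h k)) \<le> e"
    \<comment> \<open>One approximant at distance 1 suffices: \<open>g - h\<close> has bounded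
      truncations and hence lies in the space, so \<open>g\<close> is a sum of two members.\<close>
    obtain h where h: "h \<in> l0_p p" "\<And>K. p_norm p (truncate K (\<lambda>k. g k - h k)) \<le> 1"
      using ex[of 1] by auto
    have "(\<lambda>k. g k - h k) \<in> l0_p p"
      by (rule l0_p_of_truncate(1)[OF p _ h(2)]) (use g h(1) in \<open>simp add: l0_p_def\<close>)
    from p_norm_add(1)[OF p this h(1)] show "g \<in> l0_p p" by simp }
qed

lemma sequence_space_admissible:
  "admissible_space V N \<Longrightarrow> sequence_space V N"
  unfolding admissible_space_def
  using sequence_space_c0_0 sequence_space_l0_inf sequence_space_l0_p by auto

section \<open>Weighted convolutions\<close>

text \<open>The operator whose lower triangular matrix is the entrywise (Schur) product of
  \<open>w\<close> with \<open>U\<close>. The convolution, the resolvent kernels and all averages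
  used for (iii) have this form.\<close>

definition weighted_convolution ::
    "(nat \<Rightarrow> nat \<Rightarrow> complex) \<Rightarrow> (nat \<Rightarrow> nat \<Rightarrow> 'a::complex_banach \<Rightarrow>\<^sub>L 'a) \<Rightarrow>
      (nat \<Rightarrow> 'a) \<Rightarrow> nat \<Rightarrow> 'a" where
  "weighted_convolution w U f k = (\<Sum>j=0..k. w k j *\<^sub>C blinfun_apply (U k j) (f j))"

definition resolvent_weight :: "complex \<Rightarrow> nat \<Rightarrow> nat \<Rightarrow> complex" where
  "resolvent_weight z k j = inverse z ^ Suc (k - j)"

lemma weighted_convolution_cong:
  assumes "\<And>k j. j \<le> k \<Longrightarrow> w k j = w' k j"
  shows "weighted_convolution w U f = weighted_convolution w' U f"
  using assms by (auto simp: weighted_convolution_def intro!: sum.cong)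

lemma convolution_eq_weighted: "convolution U = weighted_convolution (\<lambda>k j. 1) U"
  by (auto simp: fun_eq_iff convolution_def weighted_convolution_def)

lemma resolvent_weight_one: "resolvent_weight 1 = (\<lambda>k j. 1)"
  by (auto simp: fun_eq_iff resolvent_weight_def)

section \<open>Evolution family identities and the inversion of z - T(1) on arbitrary
  sequences\<close>

lemma evolution_scaleC:
  "evolution_family U \<Longrightarrow> m \<le> n \<Longrightarrow>
    blinfun_apply (U n m) (a *\<^sub>C x) = a *\<^sub>C blinfun_apply (U n m) x"
  by (auto simp: evolution_family_def complex_blinfuns_def)

lemma evolution_compose:
  "evolution_family U \<Longrightarrow> n \<le> p \<Longrightarrow> p \<le> m \<Longrightarrow> U m n = U m p o\<^sub>L U p n"
  unfolding evolution_family_def by blast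

lemma evolution_refl [simp]: "evolution_family U \<Longrightarrow> U m m = id_blinfun"
  by (auto simp: evolution_family_def)

lemma evolution_semigroup_one:
  "evolution_semigroup U (Suc 0) f k
    = (case k of 0 \<Rightarrow> 0 | Suc m \<Rightarrow> blinfun_apply (U (Suc m) m) (f m))"
  by (auto simp: evolution_semigroup_def split: nat.split)

text \<open>Since \<open>U (Suc m) m\<close> composed with \<open>U m j\<close> is
  \<open>U (Suc m) j\<close>, the semigroup operator moves row \<open>m\<close> of the kernel to row
  \<open>Suc m\<close>. There it cancels every entry of \<open>z\<close> times the kernel except the
  diagonal one, which is \<open>z * inverse z = 1\<close>.\<close>

lemma scalar_minus_weighted_convolution:
  assumes U: "evolution_family U" and z: "z \<noteq> 0"
  shows "scalar_minus z (evolution_semigroup U 1)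
      (weighted_convolution (resolvent_weight z) U f) = f"
proof
  fix k
  show "scalar_minus z (evolution_semigroup U 1)
      (weighted_convolution (resolvent_weight z) U f) k = f k"
  proof (cases k)
    case 0
    then show ?thesis
      using U z by (simp add: scalar_minus_def evolution_semigroup_one weighted_convolution_def
          resolvent_weight_def scaleC_scaleC)
  next
    case (Suc m)
    let ?R = "weighted_convolution (resolvent_weight z) U f"
    have "blinfun_apply (U (Suc m) m) (?R m)
        = (\<Sum>j=0..m. blinfun_apply (U (Suc m) m)
            (resolvent_weight z m j *\<^sub>C blinfun_apply (U m j) (f j)))"
      by (simp add: weighted_convolution_def blinfun.sum_right)
    also have "\<dots> = (\<Sum>j=0..m. resolvent_weight z m j *\<^sub>C blinfun_apply (U (Suc m) j) (f j))"
    proof (intro sum.cong refl)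
      fix j assume "j \<in> {0..m}"
      then have "U (Suc m) j = U (Suc m) m o\<^sub>L U m j"
        by (intro evolution_compose[OF U]) auto
      then show "blinfun_apply (U (Suc m) m) (resolvent_weight z m j *\<^sub>C blinfun_apply (U m j) (f j))
          = resolvent_weight z m j *\<^sub>C blinfun_apply (U (Suc m) j) (f j)"
        by (simp add: evolution_scaleC[OF U])
    qed
    finally have T: "blinfun_apply (U (Suc m) m) (?R m)
        = (\<Sum>j=0..m. resolvent_weight z m j *\<^sub>C blinfun_apply (U (Suc m) j) (f j))" .
    have "z *\<^sub>C ?R (Suc m) = (\<Sum>j=0..m. z *\<^sub>C resolvent_weight z (Suc m) j
        *\<^sub>C blinfun_apply (U (Suc m) j) (f j)) + f (Suc m)"
      using U z by (simp add: weighted_convolution_def scaleC_sum_right resolvent_weight_def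
          scaleC_scaleC scaleC_add_right)
    also have "(\<Sum>j=0..m. z *\<^sub>C resolvent_weight z (Suc m) j
        *\<^sub>C blinfun_apply (U (Suc m) j) (f j))
        = (\<Sum>j=0..m. resolvent_weight z m j *\<^sub>C blinfun_apply (U (Suc m) j) (f j))"
      using z by (intro sum.cong) (simp_all add: scaleC_scaleC resolvent_weight_def Suc_diff_le flip: mult.assoc)
    finally show ?thesis
      using T by (simp add: scalar_minus_def evolution_semigroup_one Suc)
  qed
qed

text \<open>The semigroup operator is strictly lower triangular, so the image of \<open>f\<close>
  determines the entries of \<open>f\<close> one after the other, starting at 0.\<close>

lemma inj_scalar_minus:
  fixes U :: "nat \<Rightarrow> nat \<Rightarrow> 'a::complex_banach \<Rightarrow>\<^sub>L 'a"
  assumes z: "z \<noteq> 0"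
  shows "inj (scalar_minus z (evolution_semigroup U 1))"
proof (rule injI)
  fix f g :: "nat \<Rightarrow> 'a"
  assume eq: "scalar_minus z (evolution_semigroup U 1) f
    = scalar_minus z (evolution_semigroup U 1) g"
  have cancel: "x = y" if "z *\<^sub>C x = z *\<^sub>C y" for x y :: 'a
    using that z norm_scaleC[of z "x - y"] by (simp add: scaleC_diff_right)
  have "f k = g k" for k
  proof (induction k)
    case 0
    show ?case
      using fun_cong[OF eq, of 0]
      by (intro cancel[of "f 0" "g 0"]) (simp add: scalar_minus_def evolution_semigroup_one)
  next
    case (Suc k)
    then show ?case
      using fun_cong[OF eq, of "Suc k"]
      by (intro cancel[of "f (Suc k)" "g (Suc k)"]) (simp add: scalar_minus_def evolution_semigroup_one)
  qed
  then show "f = g" by auto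
qed

text \<open>A right inverse of an injective map is also a left inverse. Holding for all sequences,
  this applies to those whose membership in \<open>V\<close> is still open.\<close>

lemma weighted_convolution_scalar_minus:
  assumes "evolution_family U" "z \<noteq> 0"
  shows "weighted_convolution (resolvent_weight z) U
    (scalar_minus z (evolution_semigroup U 1) f) = f"
  by (rule injD[OF inj_scalar_minus[of z U, OF assms(2)]])
    (rule scalar_minus_weighted_convolution[OF assms])

section \<open>Decaying kernels and resolvents on a sequence space\<close>

locale evolution_on_sequence_space = sequence_space V N
  for V :: "(nat \<Rightarrow> 'a::complex_banach) set" and N :: "(nat \<Rightarrow> 'a) \<Rightarrow> real" +
  fixes U :: "nat \<Rightarrow> nat \<Rightarrow> 'a \<Rightarrow>\<^sub>L 'a"
  assumes family: "evolution_family U"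
begin

abbreviation R :: "complex \<Rightarrow> (nat \<Rightarrow> 'a) \<Rightarrow> nat \<Rightarrow> 'a" where
  "R z \<equiv> weighted_convolution (resolvent_weight z) U"

text \<open>The operator is the sum of its subdiagonals. The \<open>n\<close>-th one is a weighted
  shift by \<open>n\<close> of norm at most \<open>M * q ^ n\<close>, so a geometric series bounds
  the sum.\<close>

lemma weighted_convolution_bounded:
  assumes q: "0 \<le> q" "q < 1" and M: "0 \<le> M"
    and le: "\<And>k j. j \<le> k \<Longrightarrow> cmod (w k j) * norm (U k j) \<le> M * q ^ (k - j)"
    and f: "f \<in> V"
  shows "weighted_convolution w U f \<in> V"
    and "N (weighted_convolution w U f) \<le> M / (1 - q) * N f"
proof -
  define D where "D n k = (if n \<le> k then w k (k - n) *\<^sub>C blinfun_apply (U k (k - n)) (f (k - n))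
      else 0)" for n k
  let ?g = "weighted_convolution w U f"
  have D: "D n \<in> V \<and> N (D n) \<le> (M * q ^ n) * N f" for n
  proof (rule dominated[OF f])
    fix k
    have "norm (D n (k + n)) \<le> cmod (w (k + n) k) * (norm (U (k + n) k) * norm (f k))"
      by (auto simp: D_def norm_scaleC intro!: mult_left_mono norm_blinfun)
    also have "\<dots> \<le> M * q ^ n * norm (f k)"
      using mult_right_mono[OF le[of k "k + n"] norm_ge_zero[of "f k"]] by (simp add: mult.assoc)
    finally show "norm (D n (k + n)) \<le> M * q ^ n * norm (f k)" .
  qed (use q M in \<open>auto simp: D_def\<close>)
  have g: "?g k = (\<Sum>n\<le>k. D n k)" for k
    unfolding weighted_convolution_def
    by (rule sum.reindex_bij_witness[of _ "\<lambda>n. k - n" "\<lambda>j. k - j"]) (auto simp: D_def)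
  \<comment> \<open>Entries up to \<open>K\<close> see only diagonals up to \<open>K\<close>, so the
    remainder after the first \<open>L\<close> diagonals agrees there with a finite sum in
    \<open>V\<close>. The bound is uniform in \<open>K\<close>, as \<open>closed\<close> requires,
    and \<open>L = 0\<close> gives the norm bound through \<open>fatou\<close>.\<close>
  have tail: "N (truncate K (\<lambda>k. ?g k - (\<Sum>n<L. D n k))) \<le> M * q ^ L / (1 - q) * N f" for K L
  proof -
    let ?h = "\<lambda>k. \<Sum>n\<in>{L..<L + K + 1}. D n k"
    have h: "?h \<in> V" "N ?h \<le> (\<Sum>n\<in>{L..<L + K + 1}. N (D n))"
      using sum_mem[of "{L..<L + K + 1}" D] D by auto
    have "truncate K (\<lambda>k. ?g k - (\<Sum>n<L. D n k)) = truncate K ?h"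
    proof
      fix k
      have "?g k = (\<Sum>n<L + K + 1. D n k)" if "k \<le> K"
        unfolding g using that by (intro sum.mono_neutral_left) (auto simp: D_def)
      moreover have "(\<Sum>n<L + K + 1. D n k) = (\<Sum>n<L. D n k) + ?h k"
        using sum.atLeastLessThan_concat[of 0 L "L + K + 1" "\<lambda>n. D n k"]
        by (simp add: atLeast0LessThan)
      ultimately show "truncate K (\<lambda>k. ?g k - (\<Sum>n<L. D n k)) k = truncate K ?h k"
        by (simp add: truncate_def)
    qed
    then have "N (truncate K (\<lambda>k. ?g k - (\<Sum>n<L. D n k))) \<le> (\<Sum>n\<in>{L..<L + K + 1}. N (D n))"
      using norm_truncate_le[OF h(1), of K] h(2) by simp
    also have "\<dots> \<le> (\<Sum>n\<in>{L..<L + K + 1}. M * q ^ n * N f)"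
      using D by (intro sum_mono) auto
    also have "\<dots> = (\<Sum>n<K + 1. M * q ^ (n + L) * N f)"
      using sum.shift_bounds_nat_ivl[of "\<lambda>n. M * q ^ n * N f" 0 L "K + 1"]
      by (simp add: atLeast0LessThan add.commute del: sum.lessThan_Suc sum.op_ivl_Suc)
    also have "\<dots> = M * N f * q ^ L * (\<Sum>n<K + 1. q ^ n)"
      unfolding sum_distrib_left by (intro sum.cong) (simp_all add: power_add mult_ac)
    also have "\<dots> \<le> M * N f * q ^ L * (1 / (1 - q))"
    proof -
      have "(\<Sum>n<K + 1. q ^ n) \<le> (\<Sum>n. q ^ n)"
        using q by (intro sum_le_suminf summable_geometric) auto
      then show ?thesis
        using q M norm_nonneg[OF f] by (intro mult_left_mono) (auto simp: suminf_geometric)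
    qed
    finally show ?thesis by (simp add: mult_ac)
  qed
  show mem: "?g \<in> V"
  proof (rule closed)
    show "?g 0 = 0"
      using vanish[OF f] by (simp add: weighted_convolution_def)
    fix e :: real assume e: "0 < e"
    have "(\<lambda>L. M * q ^ L / (1 - q) * N f) \<longlonglongrightarrow> M * 0 / (1 - q) * N f"
      using q by (intro tendsto_intros LIMSEQ_power_zero) auto
    then have "\<forall>\<^sub>F L in sequentially. M * q ^ L / (1 - q) * N f < e"
      using e by (intro order_tendstoD) auto
    then obtain L where "M * q ^ L / (1 - q) * N f < e"
      by (auto simp: eventually_sequentially)
    then have "\<forall>K. N (truncate K (\<lambda>k. ?g k - (\<Sum>n<L. D n k))) \<le> e"
      using tail[of _ L] by (meson less_imp_le order_trans)
    moreover have "(\<lambda>k. \<Sum>n<L. D n k) \<in> V"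
      using sum_mem[of "{..<L}" D] D by auto
    ultimately show "\<exists>h\<in>V. \<forall>K. N (truncate K (\<lambda>k. ?g k - h k)) \<le> e"
      by (intro bexI[of _ "\<lambda>k. \<Sum>n<L. D n k"])
  qed
  show "N ?g \<le> M / (1 - q) * N f"
    by (rule fatou[OF mem]) (use tail[of _ 0] in simp)
qed

text \<open>\<open>R z\<close> inverts z - T(1) on all sequences; what remains is that both maps
  preserve \<open>V\<close> and that \<open>R z\<close> is bounded there.\<close>

lemma resolvent_setI:
  assumes z: "z \<noteq> 0" and mem: "\<And>f. f \<in> V \<Longrightarrow> R z f \<in> V"
    and bound: "\<And>f. f \<in> V \<Longrightarrow> N (R z f) \<le> K * N f"
    and T: "\<And>f. f \<in> V \<Longrightarrow> evolution_semigroup U 1 f \<in> V"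
  shows "z \<in> resolvent_set V N (evolution_semigroup U 1)"
    and "\<And>f. f \<in> V \<Longrightarrow> resolvent V z (evolution_semigroup U 1) f = R z f"
proof -
  let ?S = "scalar_minus z (evolution_semigroup U 1)"
  have S: "?S f \<in> V" if "f \<in> V" for f
  proof -
    have "?S f = (\<lambda>k. z *\<^sub>C f k + (- 1) *\<^sub>C evolution_semigroup U 1 f k)"
      using scaleC_of_real[of "- 1" "evolution_semigroup U 1 f _"]
      by (intro ext) (simp add: scalar_minus_def)
    then show ?thesis
      using that T by (simp add: add_mem scaleC_mem)
  qed
  have inj: "inj_on ?S V"
    using inj_scalar_minus[OF z] by (rule inj_on_subset) simp
  have SR: "?S (R z f) = f" for f
    by (rule scalar_minus_weighted_convolution[OF family z])
  have "?S ` V = V"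
  proof (rule equalityI)
    show "?S ` V \<subseteq> V" using S by blast
    show "V \<subseteq> ?S ` V"
    proof
      fix f assume "f \<in> V"
      from mem[OF this] show "f \<in> ?S ` V"
        using SR[of f] by (intro image_eqI[of f ?S "R z f"]) simp_all
    qed
  qed
  with inj have bij: "bij_betw ?S V V"
    by (simp add: bij_betw_def)
  show res: "resolvent V z (evolution_semigroup U 1) f = R z f" if "f \<in> V" for f
    unfolding resolvent_def using inv_into_f_f[OF inj mem[OF that]] unfolding SR .
  have "bounded_operator V N (resolvent V z (evolution_semigroup U 1))"
    unfolding bounded_operator_def
  proof (intro conjI ballI allI exI)
    fix f g and a :: complex assume f: "f \<in> V"
    show "resolvent V z (evolution_semigroup U 1) f \<in> V"
      using f mem res by simp
    show "N (resolvent V z (evolution_semigroup U 1) f) \<le> K * N f"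
      using f bound res by simp
    have "R z (\<lambda>k. a *\<^sub>C f k) = (\<lambda>k. a *\<^sub>C R z f k)"
      by (auto simp: fun_eq_iff weighted_convolution_def evolution_scaleC[OF family]
          scaleC_sum_right scaleC_scaleC mult.commute intro!: sum.cong)
    then show "resolvent V z (evolution_semigroup U 1) (\<lambda>k. a *\<^sub>C f k)
        = (\<lambda>k. a *\<^sub>C resolvent V z (evolution_semigroup U 1) f k)"
      using f res scaleC_mem by simp
    assume g: "g \<in> V"
    have "R z (\<lambda>k. f k + g k) = (\<lambda>k. R z f k + R z g k)"
      by (auto simp: fun_eq_iff weighted_convolution_def blinfun.add_right
          scaleC_add_right sum.distrib)
    then show "resolvent V z (evolution_semigroup U 1) (\<lambda>k. f k + g k)
        = (\<lambda>k. resolvent V z (evolution_semigroup U 1) f k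
            + resolvent V z (evolution_semigroup U 1) g k)"
      using f g res add_mem by simp
  qed
  with bij show "z \<in> resolvent_set V N (evolution_semigroup U 1)"
    by (simp add: resolvent_set_def)
qed

end

section \<open>Consequences of a norm bound for the convolution\<close>

locale bounded_convolution = evolution_on_sequence_space V N U
  for V :: "(nat \<Rightarrow> 'a::complex_banach) set" and N :: "(nat \<Rightarrow> 'a) \<Rightarrow> real"
    and U :: "nat \<Rightarrow> nat \<Rightarrow> 'a \<Rightarrow>\<^sub>L 'a" +
  fixes c :: real
  assumes convolution_mem: "f \<in> V \<Longrightarrow> convolution U f \<in> V"
    and convolution_norm_le: "f \<in> V \<Longrightarrow> N (convolution U f) \<le> c * N f"
    and c_ge_1: "1 \<le> c"
begin

text \<open>The weights whose Schur product with \<open>U\<close> keeps the bound \<open>c\<close>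
  of the unweighted convolution. The class is closed under diagonal contractions on either side and
  under convex combinations; (iii) amounts to placing the truncated resolvent kernels in it.\<close>

definition multiplier :: "(nat \<Rightarrow> nat \<Rightarrow> complex) \<Rightarrow> bool" where
  "multiplier w \<longleftrightarrow> (\<forall>f\<in>V. weighted_convolution w U f \<in> V \<and>
      N (weighted_convolution w U f) \<le> c * N f)"

lemma multiplier_one: "multiplier (\<lambda>k j. 1)"
  using convolution_mem convolution_norm_le
  by (simp add: multiplier_def convolution_eq_weighted)

text \<open>The factors \<open>a k\<close> and \<open>b j\<close> are diagonal operators applied
  after and before the weighted convolution; both are contractions on \<open>V\<close> by
  solidity.\<close>

lemma multiplier_mult:
  assumes w: "multiplier w" and a: "\<And>k. cmod (a k) \<le> 1" and b: "\<And>j. cmod (b j) \<le> 1"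
  shows "multiplier (\<lambda>k j. a k * w k j * b j)"
  unfolding multiplier_def
proof
  fix f assume f: "f \<in> V"
  let ?g = "\<lambda>j. b j *\<^sub>C f j"
  have "norm (?g k) \<le> 1 * norm (f k)" for k
    using b[of k] by (simp add: norm_scaleC mult_left_le_one_le)
  note g = dominated0[of f 1 ?g, OF f zero_le_one this]
  have h: "weighted_convolution w U ?g \<in> V" "N (weighted_convolution w U ?g) \<le> c * N ?g"
    using w g by (auto simp: multiplier_def)
  have eq: "weighted_convolution (\<lambda>k j. a k * w k j * b j) U f
      = (\<lambda>k. a k *\<^sub>C weighted_convolution w U ?g k)"
    by (auto simp: fun_eq_iff weighted_convolution_def evolution_scaleC[OF family]
        scaleC_sum_right scaleC_scaleC mult.assoc intro!: sum.cong)
  have "norm (a k *\<^sub>C weighted_convolution w U ?g k) \<le> 1 * norm (weighted_convolution w U ?g k)"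
    for k
    using a[of k] by (simp add: norm_scaleC mult_left_le_one_le)
  note ag = dominated0[OF h(1) zero_le_one this]
  have "(\<lambda>k. a k *\<^sub>C weighted_convolution w U ?g k) \<in> V"
    and "N (\<lambda>k. a k *\<^sub>C weighted_convolution w U ?g k) \<le> c * N ?g"
    using ag h(2) by simp_all
  moreover have "c * N ?g \<le> c * N f"
    using g(2) c_ge_1 by simp
  ultimately show "weighted_convolution (\<lambda>k j. a k * w k j * b j) U f \<in> V \<and>
      N (weighted_convolution (\<lambda>k j. a k * w k j * b j) U f) \<le> c * N f"
    unfolding eq by simp
qed

lemma multiplier_convex:
  assumes w: "multiplier w" "multiplier w'" and t: "0 \<le> t" "t \<le> 1"
  shows "multiplier (\<lambda>k j. of_real t * w k j + of_real (1 - t) * w' k j)"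
  unfolding multiplier_def
proof
  fix f assume f: "f \<in> V"
  let ?g = "weighted_convolution w U f" and ?h = "weighted_convolution w' U f"
  have g: "?g \<in> V" "N ?g \<le> c * N f" and h: "?h \<in> V" "N ?h \<le> c * N f"
    using w f by (auto simp: multiplier_def)
  let ?s = "\<lambda>k. of_real t *\<^sub>C ?g k + of_real (1 - t) *\<^sub>C ?h k"
  have eq: "weighted_convolution (\<lambda>k j. of_real t * w k j + of_real (1 - t) * w' k j) U f = ?s"
    by (simp add: fun_eq_iff weighted_convolution_def scaleC_add_left sum.distrib
        scaleC_sum_right scaleC_scaleC del: of_real_diff)
  have "N ?s \<le> t * N ?g + (1 - t) * N ?h"
    using norm_add[OF scaleC_mem[OF g(1)] scaleC_mem[OF h(1)], of "of_real t" "of_real (1 - t)"]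
      norm_scaleC_le[OF g(1), of "of_real t"] norm_scaleC_le[OF h(1), of "of_real (1 - t)"] t
    by (simp del: of_real_diff)
  also have "\<dots> \<le> t * (c * N f) + (1 - t) * (c * N f)"
    using g h t by (intro add_mono mult_left_mono) auto
  also have "\<dots> = c * N f"
    by (simp add: algebra_simps)
  finally show "weighted_convolution (\<lambda>k j. of_real t * w k j + of_real (1 - t) * w' k j) U f \<in> V \<and>
      N (weighted_convolution (\<lambda>k j. of_real t * w k j + of_real (1 - t) * w' k j) U f) \<le> c * N f"
    unfolding eq using add_mem[OF scaleC_mem[OF g(1)] scaleC_mem[OF h(1)]] by simp
qed

lemma multiplier_cong:
  "multiplier w \<Longrightarrow> (\<And>k j. j \<le> k \<Longrightarrow> w k j = w' k j) \<Longrightarrow> multiplier w'"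
  unfolding multiplier_def using weighted_convolution_cong[of w w' U] by simp

text \<open>Conjugation by the signs \<open>\<epsilon>\<close>, which change after \<open>K\<close>, is isometric, and the convex combination
  \<open>(1 + s)/2 w + (1 - s)/2 \<epsilon> w \<epsilon>\<close> multiplies by \<open>s\<close> exactly the entries with \<open>j \<le> K < k\<close>.\<close>

lemma multiplier_power:
  assumes s: "0 \<le> s" "s \<le> 1"
  shows "multiplier (\<lambda>k j. of_real s ^ (min k K - min j K))"
proof (induction K)
  case 0
  then show ?case using multiplier_one by simp
next
  case (Suc K)
  \<comment> \<open>The exponent counts the cuts \<open>i < K\<close> with
    \<open>j \<le> i < k\<close>; the induction step adds the cut at \<open>K\<close>.\<close>
  define w :: "nat \<Rightarrow> nat \<Rightarrow> complex" where "w k j = of_real s ^ (min k K - min j K)" for k j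
  define e :: "nat \<Rightarrow> complex" where "e k = (if k \<le> K then 1 else - 1)" for k
  have w: "multiplier w"
    using Suc unfolding w_def .
  have "multiplier (\<lambda>k j. e k * w k j * e j)"
    by (rule multiplier_mult[OF w]) (simp_all add: e_def)
  from multiplier_convex[OF w this, of "(1 + s) / 2"] s
  have "multiplier (\<lambda>k j. of_real ((1 + s) / 2) * w k j
      + of_real (1 - (1 + s) / 2) * (e k * w k j * e j))"
    by simp
  then show ?case
  proof (rule multiplier_cong)
    fix k j :: nat assume jk: "j \<le> k"
    consider "k \<le> K" | "K < j" | "j \<le> K" "K < k" by linarith
    then show "of_real ((1 + s) / 2) * w k j + of_real (1 - (1 + s) / 2) * (e k * w k j * e j)
        = of_real s ^ (min k (Suc K) - min j (Suc K))"
    proof cases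
      case 3
      then have "min k (Suc K) - min j (Suc K) = Suc (min k K - min j K)"
        by (auto simp: min_def)
      then show ?thesis
        using 3 by (simp add: w_def e_def field_simps)
    qed (use jk in \<open>auto simp: w_def e_def min_def field_simps\<close>)
  qed
qed

text \<open>With \<open>u = z / |z|\<close> and \<open>s = 1 / |z|\<close>, the kernel entry factors
  as \<open>(inverse z * inverse u ^ k) * s ^ (k - j) * u ^ j\<close>: diagonal factors of modulus
  at most 1 around a power of \<open>s\<close>. For rows up to \<open>K\<close> that power is the
  weight of \<open>multiplier_power\<close>, and \<open>fatou\<close> reduces the claim to these
  rows.\<close>

lemma norm_R_le:
  assumes z: "1 \<le> cmod z" and f: "f \<in> V" and mem: "R z f \<in> V"
  shows "N (R z f) \<le> c * N f"
proof (rule fatou[OF mem])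
  fix K
  define s where "s = 1 / cmod z"
  define u where "u = z / of_real (cmod z)"
  have z0: "z \<noteq> 0" using z by auto
  have u: "cmod u = 1" "u \<noteq> 0"
    using z0 by (auto simp: u_def norm_divide)
  have us: "inverse z = inverse u * of_real s"
    using z0 by (simp add: u_def s_def field_simps)
  \<comment> \<open>The left diagonal factor also performs the truncation at
    \<open>K\<close>.\<close>
  define a where "a k = (if k \<le> K then inverse z * inverse u ^ k else 0)" for k
  define b where "b j = u ^ j" for j
  have "cmod (inverse z) \<le> 1"
    using z by (simp add: norm_inverse inverse_le_1_iff)
  then have a: "cmod (a k) \<le> 1" for k
    using u by (simp add: a_def norm_mult norm_power norm_inverse)
  have b: "cmod (b j) \<le> 1" for j
    using u by (simp add: b_def norm_power)
  have "0 \<le> s" "s \<le> 1"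
    using z by (auto simp: s_def divide_simps)
  from multiplier_mult[OF multiplier_power[OF this, of K] a b]
  have m: "multiplier (\<lambda>k j. a k * of_real s ^ (min k K - min j K) * b j)" .
  have "truncate K (R z f)
      = weighted_convolution (\<lambda>k j. a k * of_real s ^ (min k K - min j K) * b j) U f"
  proof
    fix k
    have "a k * of_real s ^ (min k K - min j K) * b j = resolvent_weight z k j"
      if "j \<le> k" "k \<le> K" for j
    proof -
      have "inverse u ^ k = inverse u ^ (k - j) * inverse u ^ j"
        using that by (simp flip: power_add)
      then have "inverse u ^ k * u ^ j = inverse u ^ (k - j)"
        using u by (simp add: field_simps)
      then have "inverse u ^ k * of_real s ^ (k - j) * u ^ j = inverse z ^ (k - j)"
        unfolding us power_mult_distrib by (metis mult.assoc mult.commute)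
      then show ?thesis
        using that by (simp add: a_def b_def resolvent_weight_def min_absorb1 mult.assoc)
    qed
    then show "truncate K (R z f) k
      = weighted_convolution (\<lambda>k j. a k * of_real s ^ (min k K - min j K) * b j) U f k"
      by (auto simp: truncate_def weighted_convolution_def a_def intro!: sum.cong)
  qed
  then show "N (truncate K (R z f)) \<le> c * N f"
    using m f by (auto simp: multiplier_def)
qed

text \<open>The Neumann series argument for \<open>\<rho> - T = (1 - T) - (1 - \<rho>)\<close>, on truncations: these lie
  in the space before the convolution with weight \<open>\<rho>\<close> is known to be bounded.\<close>

lemma norm_truncate_R_le:
  assumes rho: "1 - 1 / c < \<rho>" "\<rho> < 1" and f: "f \<in> V"
  shows "(1 - c * (1 - \<rho>)) * N (truncate K (R (of_real \<rho>) f)) \<le> c * N f"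
proof -
  have "1 / c \<le> 1" using c_ge_1 by simp
  with rho have rho0: "0 < \<rho>" by linarith
  let ?h = "R (of_real \<rho>) f"
  \<comment> \<open>Only the truncation of \<open>?h\<close> is fed back, so that \<open>?e\<close>
    lies in \<open>V\<close>. By causality of the convolution, entries up to \<open>K\<close> are
    unaffected.\<close>
  let ?e = "\<lambda>k. f k + of_real (1 - \<rho>) *\<^sub>C truncate K ?h k"
  have "?h 0 = 0"
    using vanish[OF f] by (simp add: weighted_convolution_def)
  then have t: "truncate K ?h \<in> V"
    by (rule truncate_mem)
  have "scalar_minus 1 (evolution_semigroup U 1) ?h k = f k + of_real (1 - \<rho>) *\<^sub>C ?h k" for k
  proof -
    have "scalar_minus (of_real \<rho>) (evolution_semigroup U 1) ?h k = f k"
      using rho0 by (subst scalar_minus_weighted_convolution[OF family]) auto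
    moreover have "1 *\<^sub>C ?h k = of_real \<rho> *\<^sub>C ?h k + of_real (1 - \<rho>) *\<^sub>C ?h k"
      by (simp flip: scaleC_add_left)
    ultimately show ?thesis
      by (simp add: scalar_minus_def algebra_simps)
  qed
  then have "scalar_minus 1 (evolution_semigroup U 1) ?h = (\<lambda>k. f k + of_real (1 - \<rho>) *\<^sub>C ?h k)"
    by (rule ext)
  then have "?h = convolution U (\<lambda>k. f k + of_real (1 - \<rho>) *\<^sub>C ?h k)"
    using weighted_convolution_scalar_minus[OF family, of 1 ?h]
    by (simp add: convolution_eq_weighted resolvent_weight_one del: of_real_diff flip: One_nat_def)
  then have "truncate K ?h = truncate K (convolution U (\<lambda>k. f k + of_real (1 - \<rho>) *\<^sub>C ?h k))"
    by (rule arg_cong)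
  also have "\<dots> = truncate K (convolution U ?e)"
    by (auto simp: truncate_def convolution_def fun_eq_iff intro!: sum.cong)
  finally have "N (truncate K ?h) = N (truncate K (convolution U ?e))"
    by simp
  also have "\<dots> \<le> c * N ?e"
  proof -
    have "?e \<in> V"
      by (rule add_mem[OF f scaleC_mem[OF t]])
    then show ?thesis
      using norm_truncate_le[OF convolution_mem] convolution_norm_le order_trans by blast
  qed
  also have "\<dots> \<le> c * (N f + (1 - \<rho>) * N (truncate K ?h))"
    using norm_add[OF f scaleC_mem[OF t], of "of_real (1 - \<rho>)"]
      norm_scaleC_le[OF t, of "of_real (1 - \<rho>)"] c_ge_1 rho
    by (intro mult_left_mono) (auto simp del: of_real_diff)
  finally show ?thesis
    by (simp add: algebra_simps)
qed

text \<open>The truncated estimate is tested on the sequence with single entry \<open>x\<close> at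
  \<open>j\<close>, whose image under \<open>R \<rho>\<close> has \<open>k\<close>-th entry
  \<open>inverse \<rho> ^ Suc (k - j)\<close> times \<open>U k j x\<close>. Members of
  \<open>V\<close> vanish at 0, so the column \<open>j = 0\<close> is reached by factoring through
  \<open>U 1 0\<close>.\<close>

lemma norm_evolution_le:
  assumes rho: "1 - 1 / c < \<rho>" "\<rho> < 1"
  obtains M where "0 \<le> M" "\<And>k j. j \<le> k \<Longrightarrow> norm (U k j) \<le> M * \<rho> ^ (k - j)"
proof -
  have "1 / c \<le> 1" using c_ge_1 by simp
  with rho have rho0: "0 < \<rho>" by linarith
  \<comment> \<open>Positivity of \<open>d\<close> is exactly the condition
    \<open>1 - 1 / c < \<rho>\<close>.\<close>
  define d where "d = 1 - c * (1 - \<rho>)"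
  have d: "0 < d"
    using rho c_ge_1 by (simp add: d_def field_simps)
  define M where "M = \<rho> * c / d"
  have M: "0 \<le> M"
    using rho0 c_ge_1 d by (simp add: M_def)
  have pos: "norm (U k j) \<le> M * \<rho> ^ (k - j)" if jk: "0 < j" "j \<le> k" for k j
  proof (rule norm_blinfun_bound)
    fix x :: 'a
    let ?f = "\<lambda>i. if i = j then x else 0"
    let ?h = "R (of_real \<rho>) ?f"
    have f: "?f \<in> V" "N ?f \<le> norm x"
      using single[OF jk(1), of x] by auto
    have "?h k = (\<Sum>i\<in>{j}. resolvent_weight (of_real \<rho>) k i *\<^sub>C blinfun_apply (U k i) (?f i))"
      unfolding weighted_convolution_def using jk
      by (intro sum.mono_neutral_right) auto
    then have "norm (?h k) = inverse \<rho> ^ Suc (k - j) * norm (blinfun_apply (U k j) x)"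
      using rho0 by (simp add: norm_scaleC resolvent_weight_def norm_mult norm_power norm_inverse)
    moreover have "norm (?h k) \<le> N (truncate k ?h)"
    proof -
      have "?h 0 = 0"
        using jk by (simp add: weighted_convolution_def)
      from coord[OF truncate_mem[of ?h k, OF this], of k] show ?thesis
        by (simp add: truncate_def)
    qed
    moreover have "d * N (truncate k ?h) \<le> c * norm x"
    proof -
      have "d * N (truncate k ?h) \<le> c * N ?f"
        unfolding d_def by (rule norm_truncate_R_le[OF rho f(1)])
      also have "\<dots> \<le> c * norm x"
        using f(2) c_ge_1 by (intro mult_left_mono) auto
      finally show ?thesis .
    qed
    then have "N (truncate k ?h) \<le> c / d * norm x"
      using d by (simp add: field_simps)
    ultimately have "inverse \<rho> ^ Suc (k - j) * norm (blinfun_apply (U k j) x) \<le> c / d * norm x"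
      by linarith
    then have "norm (blinfun_apply (U k j) x) \<le> \<rho> ^ Suc (k - j) * (c / d * norm x)"
      using rho0 by (simp add: power_inverse pos_divide_le_eq mult.commute flip: divide_inverse del: power_Suc)
    then show "norm (blinfun_apply (U k j) x) \<le> M * \<rho> ^ (k - j) * norm x"
      by (simp add: M_def mult_ac)
  qed (use M rho0 in simp)
  \<comment> \<open>The summands cover \<open>0 < j\<close>, the identity at
    \<open>k = j = 0\<close>, and \<open>U k 0\<close> with \<open>0 < k\<close>; in the last case
    only \<open>k - 1\<close> powers of \<rho> are available, hence the division by \<rho>.\<close>
  define L where "L = M + 1 + M * norm (U 1 0) / \<rho>"
  have L: "M \<le> L" "1 \<le> L" "M * norm (U 1 0) / \<rho> \<le> L"
    using M rho0 by (auto simp: L_def)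
  show ?thesis
  proof
    show "0 \<le> L" using M L by linarith
    fix k j :: nat assume jk: "j \<le> k"
    consider "0 < j" | "j = 0" "k = 0" | m where "j = 0" "k = Suc m"
      by (cases k) auto
    then show "norm (U k j) \<le> L * \<rho> ^ (k - j)"
    proof cases
      case 1
      then show ?thesis
        using pos[OF 1 jk] mult_right_mono[OF L(1), of "\<rho> ^ (k - j)"] rho0
        by (meson less_imp_le order_trans zero_le_power)
    next
      case 2
      have "norm (id_blinfun :: 'a \<Rightarrow>\<^sub>L 'a) \<le> 1"
        by (rule norm_blinfun_id_le)
      with 2 show ?thesis
        using family L by simp
    next
      case 3
      have "U k 0 = U k 1 o\<^sub>L U 1 0"
        using 3 by (intro evolution_compose[OF family]) auto
      then have "norm (U k 0) \<le> norm (U k 1) * norm (U 1 0)"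
        by (simp add: norm_blinfun_compose)
      also have "\<dots> \<le> M * \<rho> ^ m * norm (U 1 0)"
        using pos[of 1 k] 3 by (intro mult_right_mono) auto
      also have "\<dots> = M * norm (U 1 0) / \<rho> * \<rho> ^ k"
        using 3 rho0 by simp
      also have "\<dots> \<le> L * \<rho> ^ k"
        using L rho0 by (intro mult_right_mono) auto
      finally show ?thesis using 3 by simp
    qed
  qed
qed

section \<open>The evolution operator and its resolvents for |z| > 1 - 1/c\<close>

lemma evolution_semigroup_mem:
  assumes rho: "1 - 1 / c < \<rho>" "\<rho> < 1" and f: "f \<in> V"
  shows "evolution_semigroup U 1 f \<in> V"
proof -
  obtain M where M: "0 \<le> M" "\<And>k j. j \<le> k \<Longrightarrow> norm (U k j) \<le> M * \<rho> ^ (k - j)"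
    using norm_evolution_le[OF rho] by blast
  have "1 / c \<le> 1" using c_ge_1 by simp
  with rho have rho0: "0 < \<rho>" by linarith
  have "evolution_semigroup U 1 f \<in> V \<and> N (evolution_semigroup U 1 f) \<le> (M * \<rho>) * N f"
  proof (rule dominated[OF f, where n = 1])
    fix k
    have "norm (blinfun_apply (U (Suc k) k) (f k)) \<le> norm (U (Suc k) k) * norm (f k)"
      by (rule norm_blinfun)
    also have "\<dots> \<le> M * \<rho> * norm (f k)"
      using M(2)[of k "Suc k"] by (intro mult_right_mono) auto
    finally show "norm (evolution_semigroup U 1 f (k + 1)) \<le> M * \<rho> * norm (f k)"
      by (simp add: evolution_semigroup_one)
  qed (use M rho0 in \<open>auto simp: evolution_semigroup_one\<close>)
  then show ?thesis by simp
qed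

lemma R_bounded:
  assumes z: "1 - 1 / c < cmod z"
  obtains K where "\<And>f. f \<in> V \<Longrightarrow> R z f \<in> V" "\<And>f. f \<in> V \<Longrightarrow> N (R z f) \<le> K * N f"
proof -
  have c: "0 \<le> 1 - 1 / c" "1 - 1 / c < 1" using c_ge_1 by simp_all
  have z0: "z \<noteq> 0" using z c by auto
  \<comment> \<open>Below 1, so that \<open>norm_evolution_le\<close> applies; below
    \<open>cmod z\<close>, so that the resolvent kernel decays at the rate
    \<open>\<rho> / cmod z < 1\<close>.\<close>
  obtain \<rho> where rho: "1 - 1 / c < \<rho>" "\<rho> < min 1 (cmod z)"
    using dense[of "1 - 1 / c" "min 1 (cmod z)"] z c by auto
  obtain M where M: "0 \<le> M" "\<And>k j. j \<le> k \<Longrightarrow> norm (U k j) \<le> M * \<rho> ^ (k - j)"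
    using norm_evolution_le[of \<rho>] rho by auto
  have le: "cmod (resolvent_weight z k j) * norm (U k j) \<le> M / cmod z * (\<rho> / cmod z) ^ (k - j)"
    if "j \<le> k" for k j
  proof -
    have "cmod (resolvent_weight z k j) * norm (U k j)
        \<le> inverse (cmod z) ^ Suc (k - j) * (M * \<rho> ^ (k - j))"
      using M(2)[OF that]
      by (intro mult_mono) (auto simp: resolvent_weight_def norm_mult norm_power norm_inverse)
    also have "\<dots> = M / cmod z * (\<rho> / cmod z) ^ (k - j)"
      using z0 by (simp add: field_simps)
    finally show ?thesis .
  qed
  have "0 \<le> \<rho>" using rho c by linarith
  then have q: "0 \<le> \<rho> / cmod z" "\<rho> / cmod z < 1" "0 \<le> M / cmod z"
    using rho z0 M by auto
  show ?thesis
    using that weighted_convolution_bounded[OF q le] by blast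
qed

end

section \<open>The growth bound and the spectrum\<close>

lemma stable_exponential_bound:
  assumes "uniformly_exponentially_stable U"
  obtains M q where "0 \<le> M" "0 \<le> q" "q < 1" "\<And>k j. j \<le> k \<Longrightarrow> norm (U k j) \<le> M * q ^ (k - j)"
proof -
  obtain \<omega> where w: "\<omega> < 0" "\<omega> \<in> growth_rates U"
    using assms by (auto simp: uniformly_exponentially_stable_def growth_bound_def Inf_less_iff)
  then obtain M where M: "\<And>k j. j \<le> k \<Longrightarrow> exp (- \<omega> * real (k - j)) * norm (U k j) \<le> M"
    unfolding growth_rates_def bdd_above_def by blast
  have le: "norm (U k j) \<le> M * exp \<omega> ^ (k - j)" if "j \<le> k" for k j
    using mult_right_mono[OF M[OF that], of "exp (\<omega> * real (k - j))"]
    by (simp add: mult.assoc mult.left_commute mult.commute exp_minus flip: exp_of_nat_mult)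
  have "0 \<le> M"
    using M[of 0 0] order_trans[OF norm_ge_zero[of "U 0 0"]] by simp
  with le w(1) show ?thesis
    by (intro that[of M "exp \<omega>"]) auto
qed

lemma ln_in_growth_rates:
  assumes "0 < \<rho>" "\<And>k j. j \<le> k \<Longrightarrow> norm (U k j) \<le> M * \<rho> ^ (k - j)"
  shows "ln \<rho> \<in> growth_rates U"
proof -
  have "exp (- ln \<rho> * real (k - j)) * norm (U k j) \<le> M" if "j \<le> k" for k j
  proof -
    have "exp (- ln \<rho> * real (k - j)) = inverse (\<rho> ^ (k - j))"
      using assms(1) by (simp add: exp_minus exp_of_nat2_mult)
    then show ?thesis
      using assms(1) assms(2)[OF that] by (simp add: pos_divide_le_eq mult.commute flip: divide_inverse)
  qed
  then show ?thesis
    unfolding growth_rates_def bdd_above_def by blast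
qed

text \<open>Stability bounds the norm by a geometric series, and a unit vector placed at index 1
  shows that it is at least 1. Hence it is a real number \<open>c\<close>, and the estimate on the
  unit ball extends to \<open>V\<close> by homogeneity.\<close>

lemma (in evolution_on_sequence_space) bounded_convolution_of_stable:
  assumes nontrivial: "\<exists>x::'a. x \<noteq> 0" and stable: "uniformly_exponentially_stable U"
  obtains c where "convolution_norm V N U = ereal c" "bounded_convolution V N U c"
proof -
  obtain M q where q: "0 \<le> M" "0 \<le> q" "q < 1"
    and U: "\<And>k j. j \<le> k \<Longrightarrow> norm (U k j) \<le> M * q ^ (k - j)"
    using stable_exponential_bound[OF stable] by blast
  define C where "C = M / (1 - q)"
  have C: "0 \<le> C"
    using q by (simp add: C_def)
  have mem: "convolution U f \<in> V" and le: "N (convolution U f) \<le> C * N f" if "f \<in> V" for f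
    using weighted_convolution_bounded[of q M "\<lambda>k j. 1", OF q(2,3,1) _ that] U
    by (auto simp: convolution_eq_weighted C_def)
  let ?S = "convolution_norm V N U"
  have upper: "ereal (N (convolution U f)) \<le> ?S" if "f \<in> V" "N f \<le> 1" for f
    unfolding convolution_norm_def operator_norm_def using that by (intro SUP_upper) auto
  have "?S \<le> ereal C"
    unfolding convolution_norm_def operator_norm_def
  proof (rule SUP_least)
    fix f assume "f \<in> {f \<in> V. N f \<le> 1}"
    then show "ereal (N (convolution U f)) \<le> ereal C"
      using le[of f] mult_left_mono[of "N f" 1 C] C by auto
  qed
  moreover have "1 \<le> ?S"
  proof -
    obtain x :: 'a where "x \<noteq> 0" using nontrivial by blast
    define y where "y = (1 / norm x) *\<^sub>R x"
    have y: "norm y = 1"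
      using \<open>x \<noteq> 0\<close> by (simp add: y_def)
    \<comment> \<open>Index 1 is the first at which members of \<open>V\<close> may be nonzero; the
      convolution fixes this entry because \<open>U 1 1\<close> is the identity.\<close>
    let ?f = "\<lambda>k. if k = 1 then y else 0"
    have f: "?f \<in> V" "N ?f \<le> 1"
      using single[of 1 y] y by auto
    have "convolution U ?f 1 = y"
      using family by (simp add: convolution_def)
    then have "1 \<le> N (convolution U ?f)"
      using coord[OF mem[OF f(1)], of 1] y by simp
    then show ?thesis
      using upper[OF f] by (metis ereal_less_eq(3) one_ereal_def order_trans)
  qed
  ultimately obtain c where c: "?S = ereal c" "1 \<le> c"
    by (cases ?S) auto
  have "N (convolution U f) \<le> c * N f" if f: "f \<in> V" for f
  proof (cases "N f = 0")
    \<comment> \<open>A sequence of norm 0 cannot be normalized; the cruder bound with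
      \<open>C\<close> already gives 0.\<close>
    case True
    then show ?thesis using le[OF f] by simp
  next
    case False
    define a where "a = N f"
    have a: "0 < a"
      using False norm_nonneg[OF f] by (simp add: a_def)
    let ?g = "\<lambda>k. of_real (1 / a) *\<^sub>C f k"
    have g: "?g \<in> V" "N ?g \<le> 1"
      using scaleC_mem[OF f] norm_scaleC_le[OF f, of "of_real (1 / a)"] a
      by (auto simp: norm_divide a_def)
    have "convolution U f = (\<lambda>k. of_real a *\<^sub>C convolution U ?g k)"
      using a by (simp add: fun_eq_iff convolution_def evolution_scaleC[OF family]
          scaleC_scaleC flip: scaleC_sum_right)
    then have "N (convolution U f) \<le> a * N (convolution U ?g)"
      using norm_scaleC_le[OF mem[OF g(1)], of "of_real a"] a by simp
    also have "\<dots> \<le> a * c"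
      using upper[OF g] c(1) a by (intro mult_left_mono) auto
    finally show ?thesis by (simp add: a_def mult.commute)
  qed
  then have "bounded_convolution V N U c"
    using mem c(2) by unfold_locales auto
  then show ?thesis using that c(1) by blast
qed

theorem theorem1p2:
  fixes U :: "nat \<Rightarrow> nat \<Rightarrow> 'a::complex_banach \<Rightarrow>\<^sub>L 'a"
    and V :: "(nat \<Rightarrow> 'a) set"
    and N :: "(nat \<Rightarrow> 'a) \<Rightarrow> real"
  assumes nontrivial: "\<exists>x::'a. x \<noteq> 0"
    and space: "admissible_space V N"
    and family: "evolution_family U"
    and stable: "uniformly_exponentially_stable U"
  shows "growth_bound U * convolution_norm V N U \<le> - 1
    \<and> {z. ereal (cmod z) > 1 - 1 / convolution_norm V N U}
        \<subseteq> resolvent_set V N (evolution_semigroup U 1)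
    \<and> (SUP z\<in>{z. cmod z \<ge> 1}. operator_norm V N (resolvent V z (evolution_semigroup U 1)))
        \<le> convolution_norm V N U"
proof -
  interpret sequence_space V N
    by (rule sequence_space_admissible[OF space])
  interpret evolution_on_sequence_space V N U
    using family by unfold_locales
  obtain c where c: "convolution_norm V N U = ereal c" and bc: "bounded_convolution V N U c"
    using bounded_convolution_of_stable[OF nontrivial stable] .
  interpret bounded_convolution V N U c
    by (rule bc)
  have c0: "0 < c" "0 \<le> 1 - 1 / c" "1 - 1 / c < 1"
    using c_ge_1 by simp_all
  have inverse_c: "1 - 1 / convolution_norm V N U = ereal (1 - 1 / c)"
    using c0 by (simp add: c one_ereal_def)
  have T: "evolution_semigroup U 1 f \<in> V" if "f \<in> V" for f
  proof -
    obtain \<rho> where "1 - 1 / c < \<rho>" "\<rho> < 1"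
      using dense[OF c0(3)] by blast
    then show ?thesis
      using evolution_semigroup_mem that by blast
  qed
  \<comment> \<open>This contains (ii), and it identifies the resolvent with \<open>R z\<close> on
    \<open>V\<close> for use in (iii).\<close>
  have res: "z \<in> resolvent_set V N (evolution_semigroup U 1)
      \<and> (\<forall>f\<in>V. R z f \<in> V \<and> resolvent V z (evolution_semigroup U 1) f = R z f)"
    if z: "1 - 1 / c < cmod z" for z
  proof -
    have "z \<noteq> 0" using z c0 by auto
    obtain K where K: "\<And>f. f \<in> V \<Longrightarrow> R z f \<in> V" "\<And>f. f \<in> V \<Longrightarrow> N (R z f) \<le> K * N f"
      using R_bounded[OF z] by blast
    show ?thesis
      using resolvent_setI[OF \<open>z \<noteq> 0\<close> K T] K(1) by blast
  qed
  \<comment> \<open>For \<rho> between 1 - 1/c and 1 - 1/c + e, the decay of \<open>U\<close> makes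
    ln \<rho> a growth rate, and ln \<rho> \<le> \<rho> - 1 < -1/c + e.\<close>
  have "growth_bound U \<le> ereal (- (1 / c))"
  proof (rule ereal_le_epsilon2)
    fix e :: real
    assume "0 < e"
    then obtain \<rho> where rho: "1 - 1 / c < \<rho>" "\<rho> < min 1 (1 - 1 / c + e)"
      using dense[of "1 - 1 / c" "min 1 (1 - 1 / c + e)"] c0 by auto
    then have "\<rho> < 1" by simp
    with rho(1) obtain M where "\<And>k j. j \<le> k \<Longrightarrow> norm (U k j) \<le> M * \<rho> ^ (k - j)"
      using norm_evolution_le by blast
    moreover have rho0: "0 < \<rho>" using rho c0 by linarith
    ultimately have "ln \<rho> \<in> growth_rates U"
      by (intro ln_in_growth_rates)
    then have "growth_bound U \<le> ereal (ln \<rho>)"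
      unfolding growth_bound_def by (intro Inf_lower imageI)
    also have "\<dots> \<le> ereal (- (1 / c)) + ereal e"
      using ln_le_minus_one[OF rho0] rho by simp
    finally show "growth_bound U \<le> ereal (- (1 / c)) + ereal e" .
  qed
  \<comment> \<open>Multiplication by the positive real \<open>c\<close> is monotone on the extended
    reals, which includes the case of growth bound minus infinity.\<close>
  then have "growth_bound U * ereal c \<le> ereal (- (1 / c)) * ereal c"
    using c0 by (intro ereal_mult_right_mono) auto
  also have "\<dots> = - 1"
    using c0 by (simp add: one_ereal_def)
  finally have i: "growth_bound U * convolution_norm V N U \<le> - 1"
    by (simp add: c)
  \<comment> \<open>Here \<open>cmod z\<close> exceeds 1 - 1/c, so the resolvent is
    \<open>R z\<close> and \<open>norm_R_le\<close> applies.\<close>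
  have iii: "operator_norm V N (resolvent V z (evolution_semigroup U 1)) \<le> ereal c"
    if z: "1 \<le> cmod z" for z
    unfolding operator_norm_def
  proof (rule SUP_least)
    fix f assume "f \<in> {f \<in> V. N f \<le> 1}"
    then have f: "f \<in> V" "N f \<le> 1" by auto
    have "1 - 1 / c < cmod z" using z c0 by linarith
    from res[OF this] f have R: "R z f \<in> V" "resolvent V z (evolution_semigroup U 1) f = R z f"
      by blast+
    have "N (R z f) \<le> c * N f"
      by (rule norm_R_le[OF z f(1) R(1)])
    also have "\<dots> \<le> c"
      using f(2) c0 by (simp add: mult_left_le)
    finally show "ereal (N (resolvent V z (evolution_semigroup U 1) f)) \<le> ereal c"
      unfolding R(2) by simp
  qed
  show ?thesis
    unfolding inverse_c using i res iii by (auto simp: c intro!: SUP_least)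
qed

end
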